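(* Let $M$ be a connected surface in $E^3$ without parabolic points (i.e. its Gauss curvature $K$ vanishes nowhere), and let $H$ be its mean curvature. Suppose that $\dfrac{H}{K}=\mu$ for a constant $\mu\neq0$ and that $M$ is not part of a sphere. Then $M$ is of null $III$-type $2$.
   Context: $M$ is a connected (sufficiently differentiable) surface in Euclidean 3-space $E^3$ with position vector $x=x(u^1,u^2)$ and Gauss map (unit normal) $n:M\to S^2$. With $g_{ij}=\langle x_{/i},x_{/j}\rangle$, $b_{ij}=\langle x_{/ij},n\rangle$, where $/i$ denotes $\partial/\partial u^i$, one has $2H=g^{ij}b_{ij}$ and $K=\det(b_{ij})/\det(g_{ij})$. The third fundamental form is $III=e_{ij}\,du^i\,du^j$ with $e_{ij}=\langle n_{/i},n_{/j}\rangle$; since $K\neq0$ it is nondegenerate, and $(e^{ij})$ denotes the inverse of $(e_{ij})$. The second Beltrami operator with respect to $III$ is $\Delta^{III}\varphi:=-e^{ij}\nabla^{III}_i\varphi_{/j}$, where $\nabla^{III}_i$ is the covariant derivative (Levi-Civita connection of $III$) in the $u^i$ direction and repeated indices are summed; it is applied componentwise to vector-valued functions. The surface $M$ is of $III$-type $k$ if $x=c+x_1+\dots+x_k$ with $c$ a constant vector and nonconstant vector-valued functions $x_i$ satisfying $\Delta^{III}x_i=\lambda_i x_i$ for pairwise different real constants $\lambda_1,\dots,\lambda_k$; it is of null $III$-type $k$ if moreover $\lambda_i=0$ for some $i\in\{1,\dots,k\}$. *)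

theory Defs
  imports "HOL-Analysis.Analysis"
begin

section \<open>Calculus in a coordinate domain\<close>

text \<open>\<open>f\<^sub>/\<^sub>i\<close>: the partial derivative of \<open>f\<close> with respect to \<open>u\<^sup>i\<close>.\<close>

definition pd :: "2 \<Rightarrow> (real^2 \<Rightarrow> 'b::real_normed_vector) \<Rightarrow> real^2 \<Rightarrow> 'b" where
  "pd i f u = frechet_derivative f (at u) (axis i 1)"

text \<open>Continuous differentiability of order \<open>k\<close>; used for open \<open>U\<close> only.\<close>

primrec Ck_on :: "nat \<Rightarrow> (real^2) set \<Rightarrow> (real^2 \<Rightarrow> 'b::real_normed_vector) \<Rightarrow> bool" where
  "Ck_on 0 U f \<longleftrightarrow> continuous_on U f"
| "Ck_on (Suc k) U f \<longleftrightarrow> f differentiable_on U \<and> (\<forall>i. Ck_on k U (pd i f))"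

section \<open>Fundamental forms and curvatures of a parametrized patch\<close>

text \<open>Here \<open>y\<close> is the position vector and \<open>m\<close> the unit normal, both as functions of \<open>(u\<^sup>1, u\<^sup>2)\<close>.\<close>

definition first_form :: "(real^2 \<Rightarrow> real^3) \<Rightarrow> real^2 \<Rightarrow> real^2^2" where
  "first_form y u = (\<chi> i j. pd i y u \<bullet> pd j y u)"

definition second_form :: "(real^2 \<Rightarrow> real^3) \<Rightarrow> (real^2 \<Rightarrow> real^3) \<Rightarrow> real^2 \<Rightarrow> real^2^2" where
  "second_form y m u = (\<chi> i j. pd j (pd i y) u \<bullet> m u)"

definition third_form :: "(real^2 \<Rightarrow> real^3) \<Rightarrow> real^2 \<Rightarrow> real^2^2" where
  "third_form m u = (\<chi> i j. pd i m u \<bullet> pd j m u)"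

definition mean_curv :: "(real^2 \<Rightarrow> real^3) \<Rightarrow> (real^2 \<Rightarrow> real^3) \<Rightarrow> real^2 \<Rightarrow> real" where
  "mean_curv y m u =
     (\<Sum>i\<in>UNIV. \<Sum>j\<in>UNIV. matrix_inv (first_form y u) $ i $ j * second_form y m u $ i $ j) / 2"

definition gauss_curv :: "(real^2 \<Rightarrow> real^3) \<Rightarrow> (real^2 \<Rightarrow> real^3) \<Rightarrow> real^2 \<Rightarrow> real" where
  "gauss_curv y m u = det (second_form y m u) / det (first_form y u)"

section \<open>Levi-Civita connection and second Beltrami operator of a metric\<close>

text \<open>\<open>christoffel e k i j\<close> is the Christoffel symbol \<open>\<Gamma>\<^sup>k\<^sub>i\<^sub>j\<close> of the metric \<open>e\<close>.\<close>

definition christoffel :: "(real^2 \<Rightarrow> real^2^2) \<Rightarrow> 2 \<Rightarrow> 2 \<Rightarrow> 2 \<Rightarrow> real^2 \<Rightarrow> real" where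
  "christoffel e k i j u =
     (\<Sum>l\<in>UNIV. matrix_inv (e u) $ k $ l *
        (pd i (\<lambda>v. e v $ j $ l) u + pd j (\<lambda>v. e v $ i $ l) u - pd l (\<lambda>v. e v $ i $ j) u)) / 2"

text \<open>\<open>cov_deriv e i \<omega> j\<close> is the component \<open>\<nabla>\<^sub>i \<omega>\<^sub>j\<close> of the covariant derivative of the covector
  field \<open>(\<omega>\<^sub>1, \<omega>\<^sub>2)\<close>. The components may be vector-valued, each coordinate of the values being then
  treated as a scalar.\<close>

definition cov_deriv ::
  "(real^2 \<Rightarrow> real^2^2) \<Rightarrow> 2 \<Rightarrow> (2 \<Rightarrow> real^2 \<Rightarrow> 'b::real_normed_vector) \<Rightarrow> 2 \<Rightarrow> real^2 \<Rightarrow> 'b" where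
  "cov_deriv e i \<omega> j u = pd i (\<omega> j) u - (\<Sum>k\<in>UNIV. christoffel e k i j u *\<^sub>R \<omega> k u)"

definition beltrami ::
  "(real^2 \<Rightarrow> real^2^2) \<Rightarrow> (real^2 \<Rightarrow> 'b::real_normed_vector) \<Rightarrow> real^2 \<Rightarrow> 'b" where
  "beltrami e f u =
     - (\<Sum>i\<in>UNIV. \<Sum>j\<in>UNIV. matrix_inv (e u) $ i $ j *\<^sub>R cov_deriv e i (\<lambda>l. pd l f) j u)"

section \<open>Surfaces\<close>

text \<open>A surface is a topological space \<open>M\<close> with a position vector \<open>X\<close> into Euclidean 3-space
  (an inclusion for embedded surfaces, the identity parametrization for a single patch). A local
  parametrization is a homeomorphism \<open>\<phi>\<close> from an open set of \<open>\<real>\<^sup>2\<close> onto an open set of \<open>M\<close> such that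
  \<open>x(u\<^sup>1, u\<^sup>2) = X (\<phi> u)\<close> is a \<open>C\<^sup>3\<close> immersion. No compatibility of overlapping parametrizations has
  to be required: as \<open>X \<circ> \<phi>\<close> is an immersion, changes of parameters are automatically \<open>C\<^sup>3\<close>.
  Order 3 is the least one for which the Christoffel symbols of the third fundamental form
  are defined.\<close>

definition local_param ::
  "'a::t2_space set \<Rightarrow> ('a \<Rightarrow> real^3) \<Rightarrow> (real^2) set \<Rightarrow> (real^2 \<Rightarrow> 'a) \<Rightarrow> bool" where
  "local_param M X U \<phi> \<longleftrightarrow>
     open U \<and> openin (top_of_set M) (\<phi> ` U) \<and> (\<exists>\<psi>. homeomorphism U (\<phi> ` U) \<phi> \<psi>) \<and>
     Ck_on 3 U (X \<circ> \<phi>) \<and> (\<forall>u\<in>U. inj (frechet_derivative (X \<circ> \<phi>) (at u)))"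

definition surface :: "'a::t2_space set \<Rightarrow> ('a \<Rightarrow> real^3) \<Rightarrow> bool" where
  "surface M X \<longleftrightarrow> (\<forall>p\<in>M. \<exists>U \<phi>. local_param M X U \<phi> \<and> p \<in> \<phi> ` U)"

definition gauss_map :: "'a::t2_space set \<Rightarrow> ('a \<Rightarrow> real^3) \<Rightarrow> ('a \<Rightarrow> real^3) \<Rightarrow> bool" where
  "gauss_map M X n \<longleftrightarrow>
     continuous_on M n \<and> n ` M \<subseteq> sphere 0 1 \<and>
     (\<forall>U \<phi>. local_param M X U \<phi> \<longrightarrow> (\<forall>u\<in>U. \<forall>i. n (\<phi> u) \<bullet> pd i (X \<circ> \<phi>) u = 0))"

text \<open>Pointwise conditions on a surface are expressed in all local parametrizations; the quantities
  concerned do not depend on the parametrization (\<open>H\<close> does depend on the choice of \<open>n\<close>, by a sign).\<close>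

definition no_parabolic_points ::
  "'a::t2_space set \<Rightarrow> ('a \<Rightarrow> real^3) \<Rightarrow> ('a \<Rightarrow> real^3) \<Rightarrow> bool" where
  "no_parabolic_points M X n \<longleftrightarrow>
     (\<forall>U \<phi>. local_param M X U \<phi> \<longrightarrow> (\<forall>u\<in>U. gauss_curv (X \<circ> \<phi>) (n \<circ> \<phi>) u \<noteq> 0))"

definition curv_ratio_const ::
  "'a::t2_space set \<Rightarrow> ('a \<Rightarrow> real^3) \<Rightarrow> ('a \<Rightarrow> real^3) \<Rightarrow> real \<Rightarrow> bool" where
  "curv_ratio_const M X n \<mu> \<longleftrightarrow>
     (\<forall>U \<phi>. local_param M X U \<phi> \<longrightarrow>
        (\<forall>u\<in>U. mean_curv (X \<circ> \<phi>) (n \<circ> \<phi>) u / gauss_curv (X \<circ> \<phi>) (n \<circ> \<phi>) u = \<mu>))"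

definition part_of_sphere :: "'a set \<Rightarrow> ('a \<Rightarrow> real^3) \<Rightarrow> bool" where
  "part_of_sphere M X \<longleftrightarrow> (\<exists>a r. r > 0 \<and> X ` M \<subseteq> sphere a r)"

section \<open>Surfaces of finite type with respect to the third fundamental form\<close>

definition III_eigen ::
  "'a::t2_space set \<Rightarrow> ('a \<Rightarrow> real^3) \<Rightarrow> ('a \<Rightarrow> real^3) \<Rightarrow> real \<Rightarrow> ('a \<Rightarrow> real^3) \<Rightarrow> bool" where
  "III_eigen M X n ev f \<longleftrightarrow>
     (\<forall>U \<phi>. local_param M X U \<phi> \<longrightarrow>
        Ck_on 2 U (f \<circ> \<phi>) \<and>
        (\<forall>u\<in>U. beltrami (third_form (n \<circ> \<phi>)) (f \<circ> \<phi>) u = ev *\<^sub>R f (\<phi> u)))"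

definition III_decomposition ::
  "'a::t2_space set \<Rightarrow> ('a \<Rightarrow> real^3) \<Rightarrow> ('a \<Rightarrow> real^3) \<Rightarrow> nat \<Rightarrow>
    real^3 \<Rightarrow> (nat \<Rightarrow> 'a \<Rightarrow> real^3) \<Rightarrow> (nat \<Rightarrow> real) \<Rightarrow> bool" where
  "III_decomposition M X n k c f ev \<longleftrightarrow>
     (\<forall>p\<in>M. X p = c + (\<Sum>i=1..k. f i p)) \<and>
     (\<forall>i\<in>{1..k}. \<not> f i constant_on M \<and> III_eigen M X n (ev i) (f i)) \<and>
     inj_on ev {1..k}"

definition III_type :: "'a::t2_space set \<Rightarrow> ('a \<Rightarrow> real^3) \<Rightarrow> ('a \<Rightarrow> real^3) \<Rightarrow> nat \<Rightarrow> bool" where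
  "III_type M X n k \<longleftrightarrow> (\<exists>c f ev. III_decomposition M X n k c f ev)"

definition null_III_type :: "'a::t2_space set \<Rightarrow> ('a \<Rightarrow> real^3) \<Rightarrow> ('a \<Rightarrow> real^3) \<Rightarrow> nat \<Rightarrow> bool" where
  "null_III_type M X n k \<longleftrightarrow>
     (\<exists>c f ev. III_decomposition M X n k c f ev \<and> (\<exists>i\<in>{1..k}. ev i = 0))"

end

theory Submission
  imports Defs
begin

text \<open>The Gauss map is an isometry from \<open>(M, III)\<close> into the unit sphere, so \<open>\<Delta>\<^sup>I\<^sup>I\<^sup>I n = 2 n\<close>. The map
  \<open>y = x + \<mu> n\<close> is harmonic: its derivatives are tangent, and the tensor \<open>c\<^sub>i\<^sub>j = y\<^sub>/\<^sub>i \<bullet> n\<^sub>/\<^sub>j = - b\<^sub>i\<^sub>j + \<mu> e\<^sub>i\<^sub>j\<close> is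
  symmetric, satisfies the Codazzi equation with respect to \<open>III\<close>, and has \<open>III\<close>-trace
  \<open>-2H/K + 2\<mu> = 0\<close>. Hence \<open>\<Delta>\<^sup>I\<^sup>I\<^sup>I y\<close> has vanishing normal part (the trace of \<open>c\<close>) and vanishing tangential
  part (the divergence of \<open>c\<close>, which equals the gradient of its trace). So
  \<open>x = (x + \<mu> n) + (- \<mu> n)\<close> is the required decomposition, with eigenvalues 0 and 2: the first summand
  is not constant as \<open>M\<close> does not lie on a sphere of radius \<open>\<bar>\<mu>\<bar>\<close>, and the second one since \<open>K \<noteq> 0\<close>.\<close>

section \<open>Partial derivatives\<close>

lemma pd_eqI:
  assumes "(f has_derivative f') (at u)"
  shows "pd i f u = f' (axis i 1)"
  using frechet_derivative_at[OF assms] by (simp add: pd_def)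

lemma pd_const [simp]: "pd i (\<lambda>_. c) u = 0"
  by (simp add: pd_def)

text \<open>Identities such as \<open>m u \<bullet> m u = 1\<close> are known on \<open>U\<close>
  only, while \<open>pd\<close> acts on total functions. Openness of \<open>U\<close> makes both
  functions have the same candidate derivatives, so identities may be differentiated inside
  \<open>U\<close>.\<close>

lemma pd_cong:
  assumes "open U" "u \<in> U" "\<And>v. v \<in> U \<Longrightarrow> f v = g v"
  shows "pd i f u = pd i g u"
proof -
  have "(f has_derivative f') (at u) \<longleftrightarrow> (g has_derivative f') (at u)" for f'
    using has_derivative_transform_within_open[of f f' u UNIV U g]
      has_derivative_transform_within_open[of g f' u UNIV U f] assms by auto
  then show ?thesis by (simp add: pd_def frechet_derivative_def)
qed

lemma has_derivative_pd:
  assumes "f differentiable (at u)"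
  shows "(f has_derivative frechet_derivative f (at u)) (at u)"
  using assms by (simp add: frechet_derivative_works)

lemma pd_bilinear:
  assumes "bounded_bilinear bop" "f differentiable (at u)" "g differentiable (at u)"
  shows "pd i (\<lambda>u. bop (f u) (g u)) u = bop (f u) (pd i g u) + bop (pd i f u) (g u)"
  using pd_eqI[OF bounded_bilinear.FDERIV[OF assms(1) has_derivative_pd[OF assms(2)] has_derivative_pd[OF assms(3)]]]
  by (simp add: pd_def)

lemmas pd_inner = pd_bilinear[OF bounded_bilinear_inner]

lemma pd_add:
  assumes "f differentiable (at u)" "g differentiable (at u)"
  shows "pd i (\<lambda>u. f u + g u) u = pd i f u + pd i g u"
  using pd_eqI[OF has_derivative_add[OF has_derivative_pd[OF assms(1)] has_derivative_pd[OF assms(2)]]]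
  by (simp add: pd_def)

lemma pd_scaleR:
  assumes "f differentiable (at u)"
  shows "pd i (\<lambda>u. c *\<^sub>R f u) u = c *\<^sub>R pd i f u"
  using pd_eqI[OF has_derivative_scaleR_right[OF has_derivative_pd[OF assms]]]
  by (simp add: pd_def)

section \<open>Closure properties of the classes C^k\<close>

lemma Ck_on_Suc_differentiable:
  assumes "open U" "Ck_on (Suc k) U f" "u \<in> U"
  shows "f differentiable (at u)"
  using assms by (simp add: differentiable_on_eq_differentiable_at)

lemma Ck_on_pd: "Ck_on (Suc k) U f \<Longrightarrow> Ck_on k U (pd i f)"
  by simp

lemma Ck_on_cong:
  assumes "open U" "\<And>u. u \<in> U \<Longrightarrow> f u = g u" "Ck_on k U f"
  shows "Ck_on k U g"
  using assms(2,3)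
proof (induction k arbitrary: f g)
  case 0
  then show ?case by (simp cong: continuous_on_cong)
next
  case (Suc k)
  have "g differentiable_on U"
    using Suc.prems has_derivative_transform[of _ U g f] by (force simp: differentiable_on_def differentiable_def)
  moreover have "Ck_on k U (pd i g)" for i
    by (rule Suc.IH[of "pd i f"], rule pd_cong[OF assms(1)]) (use Suc.prems in auto)
  ultimately show ?case by simp
qed

lemma Ck_on_SucD:
  assumes "Ck_on (Suc k) U f"
  shows "Ck_on k U f"
  using assms
proof (induction k arbitrary: f)
  case 0
  then show ?case by (simp add: differentiable_imp_continuous_on)
next
  case (Suc k)
  then show ?case by simp
qed

lemma Ck_on_const [simp]: "Ck_on k U (\<lambda>_. c)"
proof (induction k arbitrary: c)
  case (Suc k)
  have "pd i (\<lambda>_::real^2. c) = (\<lambda>_. 0)" for i by auto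
  then show ?case using Suc by simp
qed simp

lemma Ck_on_add:
  assumes "open U" "Ck_on k U f" "Ck_on k U g"
  shows "Ck_on k U (\<lambda>u. f u + g u)"
  using assms(2,3)
proof (induction k arbitrary: f g)
  case 0
  then show ?case by (simp add: continuous_on_add)
next
  case (Suc k)
  have d: "f differentiable (at u)" "g differentiable (at u)" if "u \<in> U" for u
    using Ck_on_Suc_differentiable[OF assms(1)] Suc.prems that by blast+
  have "Ck_on k U (pd i (\<lambda>u. f u + g u))" for i
    by (rule Ck_on_cong[OF assms(1) _ Suc.IH[of "pd i f" "pd i g"]])
      (use Suc.prems in \<open>auto simp: pd_add d\<close>)
  then show ?case using Suc.prems by (simp add: differentiable_on_add)
qed

text \<open>The product rule leaves one factor undifferentiated; \<open>Ck_on_SucD\<close> lowers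
  its order so that the induction hypothesis applies. The general form covers scalar, inner and
  cross products at once.\<close>

lemma Ck_on_bilinear:
  assumes "bounded_bilinear bop" "open U" "Ck_on k U f" "Ck_on k U g"
  shows "Ck_on k U (\<lambda>u. bop (f u) (g u))"
  using assms(3,4)
proof (induction k arbitrary: f g)
  case 0
  then show ?case by (simp add: bounded_bilinear.continuous_on[OF assms(1)])
next
  case (Suc k)
  have d: "f differentiable (at u)" "g differentiable (at u)" if "u \<in> U" for u
    using Ck_on_Suc_differentiable[OF assms(2)] Suc.prems that by blast+
  have "Ck_on k U (pd i (\<lambda>u. bop (f u) (g u)))" for i
  proof (rule Ck_on_cong[OF assms(2)])
    show "Ck_on k U (\<lambda>u. bop (f u) (pd i g u) + bop (pd i f u) (g u))"
      by (intro Ck_on_add[OF assms(2)] Suc.IH Ck_on_SucD[OF Suc.prems(1)] Ck_on_SucD[OF Suc.prems(2)]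
          Ck_on_pd Suc.prems)
  qed (simp add: pd_bilinear[OF assms(1)] d)
  moreover have "(\<lambda>u. bop (f u) (g u)) differentiable_on U"
    using bounded_bilinear.FDERIV[OF assms(1) has_derivative_pd[OF d(1)] has_derivative_pd[OF d(2)]]
    by (force simp: differentiable_on_eq_differentiable_at[OF assms(2)] differentiable_def)
  ultimately show ?case by simp
qed

lemmas Ck_on_scaleR = Ck_on_bilinear[OF bounded_bilinear_scaleR]
lemmas Ck_on_mult = Ck_on_bilinear[OF bounded_bilinear_mult]
lemmas Ck_on_inner = Ck_on_bilinear[OF bounded_bilinear_inner]

text \<open>With r = f^(-1/2) the derivative is -(1/2) r^3 f', a product of r and f'. Induction
  therefore closes with products alone, without a C^k chain rule. It serves to normalise a cross
  product.\<close>

lemma Ck_on_inverse_sqrt: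
  assumes "open U" "\<And>u. u \<in> U \<Longrightarrow> f u > 0" "Ck_on k U f"
  shows "Ck_on k U (\<lambda>u. 1 / sqrt (f u))"
  using assms(3)
proof (induction k)
  case 0
  then show ?case using assms(2) by (auto intro!: continuous_intros dest: assms(2))
next
  case (Suc k)
  let ?r = "\<lambda>u. 1 / sqrt (f u)"
  have der: "(?r has_derivative (\<lambda>h. (- 1 / 2) * (?r u * (?r u * ?r u)) * frechet_derivative f (at u) h)) (at u)"
    if "u \<in> U" for u
  proof -
    have p: "f u > 0" using assms(2) that .
    have "((\<lambda>x. 1 / sqrt x) has_real_derivative (- 1 / 2) * (?r u * (?r u * ?r u))) (at (f u))"
      using p by (auto intro!: derivative_eq_intros simp: field_simps)
    then show ?thesis
      using DERIV_compose_FDERIV has_derivative_pd[OF Ck_on_Suc_differentiable[OF assms(1) Suc.prems that]]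
      by (fastforce simp: mult.commute)
  qed
  have r: "Ck_on k U ?r" using Suc.IH Ck_on_SucD[OF Suc.prems] by simp
  have "Ck_on k U (pd i ?r)" for i
  proof (rule Ck_on_cong[OF assms(1)])
    show "Ck_on k U (\<lambda>u. (- 1 / 2) * (?r u * (?r u * ?r u)) * pd i f u)"
      using Suc.prems by (intro Ck_on_mult[OF assms(1)] r Ck_on_const) auto
  qed (subst pd_eqI[OF der], auto simp: pd_def)
  moreover have "?r differentiable_on U"
    using der by (force simp: differentiable_on_eq_differentiable_at[OF assms(1)] differentiable_def)
  ultimately show ?case by simp
qed

section \<open>Symmetry of second derivatives\<close>

text \<open>The second difference of \<open>f\<close> over a square of side \<open>h\<close> is
  \<open>h * h\<close> times either mixed derivative at some point of the square. Shrinking the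
  square and using continuity identifies the two values at \<open>u\<close>.\<close>

lemma pd_commute_real:
  fixes f :: "real^2 \<Rightarrow> real"
  assumes U: "open U" "u \<in> U" and f: "Ck_on 2 U f"
  shows "pd j (pd i f) u = pd i (pd j f) u"
proof -
  have mixed: "\<exists>\<xi> \<eta>. 0 < \<xi> \<and> \<xi> < h \<and> 0 < \<eta> \<and> \<eta> < h \<and>
      f (u + h *\<^sub>R axis i 1 + h *\<^sub>R axis j 1) - f (u + h *\<^sub>R axis i 1) - f (u + h *\<^sub>R axis j 1) + f u
        = h * h * pd j (pd i f) (u + \<xi> *\<^sub>R axis i 1 + \<eta> *\<^sub>R axis j 1)"
    if h: "h > 0" and sub: "\<And>s t. \<lbrakk>0 \<le> s; s \<le> h; 0 \<le> t; t \<le> h\<rbrakk> \<Longrightarrow> u + s *\<^sub>R axis i 1 + t *\<^sub>R axis j 1 \<in> U"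
    for h i j
  proof -
    have line: "((\<lambda>t. g (w + t *\<^sub>R axis l 1)) has_real_derivative pd l g (w + t *\<^sub>R axis l 1)) (at t)"
      if "g differentiable (at (w + t *\<^sub>R axis l 1))" for g :: "real^2 \<Rightarrow> real" and w l t
    proof -
      have "((\<lambda>t. w + t *\<^sub>R axis l 1) has_derivative (\<lambda>h. h *\<^sub>R axis l 1)) (at t)"
        by (auto intro!: derivative_eq_intros)
      from diff_chain_at[OF this has_derivative_pd[OF that]]
      have "((\<lambda>t. g (w + t *\<^sub>R axis l 1)) has_derivative
          (\<lambda>h. frechet_derivative g (at (w + t *\<^sub>R axis l 1)) (h *\<^sub>R axis l 1))) (at t)"
        by (simp add: o_def)
      moreover have "(\<lambda>h. frechet_derivative g (at (w + t *\<^sub>R axis l 1)) (h *\<^sub>R axis l 1)) = (*) (pd l g (w + t *\<^sub>R axis l 1))"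
        using linear_cmul[OF has_derivative_linear[OF has_derivative_pd[OF that]]] by (auto simp: pd_def)
      ultimately show ?thesis by (simp add: has_field_derivative_def)
    qed
    have d: "f differentiable (at v)" "pd l f differentiable (at v)" if "v \<in> U" for v l
      using Ck_on_Suc_differentiable[OF U(1), of 1 f] Ck_on_Suc_differentiable[OF U(1), of 0 "pd l f"] f that
      by (auto simp: numeral_2_eq_2)
    let ?a = "axis i 1 :: real^2" and ?b = "axis j 1 :: real^2"
    \<comment> \<open>First mean value step: direction \<open>i\<close>, applied to the difference
      of \<open>f\<close> across the square in direction \<open>j\<close>. The second one, below,
      runs in direction \<open>j\<close>.\<close>
    have "\<exists>z. 0 < z \<and> z < h \<and>
        (f (u + h *\<^sub>R ?b + h *\<^sub>R ?a) - f (u + h *\<^sub>R ?a)) - (f (u + h *\<^sub>R ?b + 0 *\<^sub>R ?a) - f (u + 0 *\<^sub>R ?a)) =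
        (h - 0) * (pd i f (u + h *\<^sub>R ?b + z *\<^sub>R ?a) - pd i f (u + z *\<^sub>R ?a))"
      apply (rule MVT2[where f = "\<lambda>t. f (u + h *\<^sub>R ?b + t *\<^sub>R ?a) - f (u + t *\<^sub>R ?a)"
          and f' = "\<lambda>t. pd i f (u + h *\<^sub>R ?b + t *\<^sub>R ?a) - pd i f (u + t *\<^sub>R ?a)"])
      using h apply simp
      apply (intro DERIV_diff line d)
      using sub[of _ h] sub[of _ 0] h by (auto simp: algebra_simps)
    then obtain \<xi> where \<xi>: "0 < \<xi>" "\<xi> < h" and
      e1: "f (u + h *\<^sub>R ?b + h *\<^sub>R ?a) - f (u + h *\<^sub>R ?a) - (f (u + h *\<^sub>R ?b) - f u) =
        h * (pd i f (u + h *\<^sub>R ?b + \<xi> *\<^sub>R ?a) - pd i f (u + \<xi> *\<^sub>R ?a))" by auto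
    have "\<exists>z. 0 < z \<and> z < h \<and>
        pd i f (u + \<xi> *\<^sub>R ?a + h *\<^sub>R ?b) - pd i f (u + \<xi> *\<^sub>R ?a + 0 *\<^sub>R ?b) =
        (h - 0) * pd j (pd i f) (u + \<xi> *\<^sub>R ?a + z *\<^sub>R ?b)"
      apply (rule MVT2[where f = "\<lambda>t. pd i f (u + \<xi> *\<^sub>R ?a + t *\<^sub>R ?b)"
          and f' = "\<lambda>t. pd j (pd i f) (u + \<xi> *\<^sub>R ?a + t *\<^sub>R ?b)"])
      using h apply simp
      apply (intro line d)
      using sub[of \<xi>] \<xi> by auto
    then obtain \<eta> where \<eta>: "0 < \<eta>" "\<eta> < h" and
      e2: "pd i f (u + \<xi> *\<^sub>R ?a + h *\<^sub>R ?b) - pd i f (u + \<xi> *\<^sub>R ?a) =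
        h * pd j (pd i f) (u + \<xi> *\<^sub>R ?a + \<eta> *\<^sub>R ?b)" by auto
    have c: "u + h *\<^sub>R ?b + h *\<^sub>R ?a = u + h *\<^sub>R ?a + h *\<^sub>R ?b" "u + h *\<^sub>R ?b + \<xi> *\<^sub>R ?a = u + \<xi> *\<^sub>R ?a + h *\<^sub>R ?b"
      by (simp_all add: algebra_simps)
    show ?thesis
      using e1 \<xi> \<eta> unfolding c e2 by (intro exI[of _ \<xi>] exI[of _ \<eta>]) (auto simp: algebra_simps)
  qed
  have cont: "continuous (at u) (pd j (pd i f))" for i j
    using f U by (auto simp: numeral_2_eq_2 continuous_on_eq_continuous_at)
  have "\<bar>pd j (pd i f) u - pd i (pd j f) u\<bar> < \<epsilon>" if "\<epsilon> > 0" for \<epsilon>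
  proof -
    obtain d1 where d1: "d1 > 0" "\<And>v. dist v u < d1 \<Longrightarrow> dist (pd j (pd i f) v) (pd j (pd i f) u) < \<epsilon> / 2"
      using cont[of j i] \<open>\<epsilon> > 0\<close> unfolding continuous_at_eps_delta by (metis half_gt_zero)
    obtain d2 where d2: "d2 > 0" "\<And>v. dist v u < d2 \<Longrightarrow> dist (pd i (pd j f) v) (pd i (pd j f) u) < \<epsilon> / 2"
      using cont[of i j] \<open>\<epsilon> > 0\<close> unfolding continuous_at_eps_delta by (metis half_gt_zero)
    obtain r where r: "r > 0" "ball u r \<subseteq> U" using U openE by blast
    \<comment> \<open>Points of the square are at distance at most 2h from \<open>u\<close>; the
      factor 1/3 keeps this strictly below all three radii.\<close>
    define h where "h = min r (min d1 d2) / 3"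
    have h: "h > 0" using r d1 d2 by (simp add: h_def)
    have near: "dist (u + s *\<^sub>R axis k 1 + t *\<^sub>R axis l 1) u < min r (min d1 d2)"
      if "0 \<le> s" "s \<le> h" "0 \<le> t" "t \<le> h" for s t and k l :: 2
    proof -
      have "norm (s *\<^sub>R axis k 1 + t *\<^sub>R axis l (1::real)) \<le> s + t"
        by (rule norm_triangle_le) (use that in \<open>simp add: norm_axis_1\<close>)
      then show ?thesis using that h by (simp add: dist_norm h_def add.assoc)
    qed
    have sub: "u + s *\<^sub>R axis k 1 + t *\<^sub>R axis l 1 \<in> U" if "0 \<le> s" "s \<le> h" "0 \<le> t" "t \<le> h" for s t k l
      using near[OF that, of k l] r by (auto simp: dist_commute)
    have mean: "\<exists>v. dist v u < min r (min d1 d2) \<and>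
        f (u + h *\<^sub>R axis i 1 + h *\<^sub>R axis j 1) - f (u + h *\<^sub>R axis i 1) - f (u + h *\<^sub>R axis j 1) + f u
        = h * h * pd j (pd i f) v" for i j
    proof -
      obtain \<xi> \<eta> where "0 < \<xi>" "\<xi> < h" "0 < \<eta>" "\<eta> < h" and
        "f (u + h *\<^sub>R axis i 1 + h *\<^sub>R axis j 1) - f (u + h *\<^sub>R axis i 1) - f (u + h *\<^sub>R axis j 1) + f u
        = h * h * pd j (pd i f) (u + \<xi> *\<^sub>R axis i 1 + \<eta> *\<^sub>R axis j 1)"
        using mixed[OF h, of i j] sub by blast
      then show ?thesis using near[of \<xi> \<eta> i j] by (intro exI conjI) auto
    qed
    obtain v where v: "dist v u < min r (min d1 d2)" and
      ev: "f (u + h *\<^sub>R axis i 1 + h *\<^sub>R axis j 1) - f (u + h *\<^sub>R axis i 1) - f (u + h *\<^sub>R axis j 1) + f u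
        = h * h * pd j (pd i f) v"
      using mean by blast
    obtain w where w: "dist w u < min r (min d1 d2)" and
      ew: "f (u + h *\<^sub>R axis j 1 + h *\<^sub>R axis i 1) - f (u + h *\<^sub>R axis j 1) - f (u + h *\<^sub>R axis i 1) + f u
        = h * h * pd i (pd j f) w"
      using mean by blast
    \<comment> \<open>The second difference does not change when \<open>i\<close> and
      \<open>j\<close> are exchanged.\<close>
    have "h * h * pd j (pd i f) v = h * h * pd i (pd j f) w"
      using ev ew by (simp add: algebra_simps)
    then have "pd j (pd i f) v = pd i (pd j f) w" using h by simp
    moreover have "dist (pd j (pd i f) v) (pd j (pd i f) u) < \<epsilon> / 2" using v by (intro d1) simp
    moreover have "dist (pd i (pd j f) w) (pd i (pd j f) u) < \<epsilon> / 2" using w by (intro d2) simp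
    ultimately show ?thesis unfolding dist_real_def by linarith
  qed
  \<comment> \<open>Were the difference nonzero, its absolute value would be an admissible
    \<epsilon>, hence less than itself.\<close>
  from this[of "\<bar>pd j (pd i f) u - pd i (pd j f) u\<bar>"] show ?thesis by force
qed

text \<open>Pairing with a constant vector \<open>w\<close> reduces the claim to the scalar
  case.\<close>

lemma pd_commute:
  fixes f :: "real^2 \<Rightarrow> 'b::real_inner"
  assumes U: "open U" "u \<in> U" and f: "Ck_on 2 U f"
  shows "pd j (pd i f) u = pd i (pd j f) u"
proof -
  have d: "f differentiable (at v)" "pd l f differentiable (at v)" if "v \<in> U" for v l
    using Ck_on_Suc_differentiable[OF U(1), of 1 f] Ck_on_Suc_differentiable[OF U(1), of 0 "pd l f"] f that
    by (auto simp: numeral_2_eq_2)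
  have "pd j (pd i f) u \<bullet> w = pd i (pd j f) u \<bullet> w" for w
  proof -
    have 1: "pd l (\<lambda>v. f v \<bullet> w) v = pd l f v \<bullet> w" if "v \<in> U" for l v
      using d(1)[OF that] by (simp add: pd_inner)
    have "pd k (pd l (\<lambda>v. f v \<bullet> w)) u = pd k (pd l f) u \<bullet> w" for k l
      using pd_cong[OF U, of "pd l (\<lambda>v. f v \<bullet> w)" "\<lambda>v. pd l f v \<bullet> w" k] 1 d(2)[OF U(2)]
      by (simp add: pd_inner)
    moreover have "Ck_on 2 U (\<lambda>v. f v \<bullet> w)"
      by (intro Ck_on_inner U f Ck_on_const)
    ultimately show ?thesis using pd_commute_real[OF U] by metis
  qed
  then show ?thesis using vector_eq_rdot by blast
qed

section \<open>Second Beltrami operator of the third fundamental form\<close>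

lemma matrix_inv_2:
  fixes A :: "real^2^2"
  assumes "det A \<noteq> 0"
  shows "matrix_inv A = vector [vector [A$2$2 / det A, - A$1$2 / det A], vector [- A$2$1 / det A, A$1$1 / det A]]"
    (is "_ = ?B")
proof -
  have X: "A$1$1 * A$2$2 / det A - A$1$2 * A$2$1 / det A = 1"
    using assms by (simp add: det_2 flip: diff_divide_distrib)
  have AB: "A ** ?B = mat 1" "?B ** A = mat 1"
    using assms
    by (simp_all add: matrix_matrix_mult_def mat_def vec_eq_iff forall_2 sum_2 mult.commute)
      (use X in \<open>simp_all add: mult.commute\<close>)
  \<comment> \<open>\<open>matrix_inv\<close> is a Hilbert choice: the adjugate formula
    \<open>?B\<close> shows that it does choose an inverse, and uniqueness of inverses then
    identifies it with \<open>?B\<close>.\<close>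
  have "A ** matrix_inv A = mat 1 \<and> matrix_inv A ** A = mat 1"
    unfolding matrix_inv_def by (rule someI[of _ ?B]) (use AB in blast)
  then have "matrix_inv A = matrix_inv A ** (A ** ?B)" "(matrix_inv A ** A) ** ?B = ?B"
    unfolding AB by (simp_all only: matrix_mul_lid matrix_mul_rid)
  then show ?thesis by (simp only: matrix_mul_assoc)
qed

text \<open>For c = a x b, the triple product identity gives n x c = 0; expanding n x (n x c) = 0 by
  the same identity yields the claim.\<close>

lemma cross3_normal:
  fixes a b n :: "real^3"
  assumes "n \<bullet> n = 1" "n \<bullet> a = 0" "n \<bullet> b = 0"
  shows "cross3 a b = (n \<bullet> cross3 a b) *\<^sub>R n"
proof -
  have "cross3 n (cross3 a b) = 0" using assms by (simp add: Lagrange)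
  then have "(n \<bullet> cross3 a b) *\<^sub>R n - (n \<bullet> n) *\<^sub>R cross3 a b = 0" by (metis Lagrange cross_zero_right)
  then show ?thesis using assms(1) by simp
qed

text \<open>The squared length of a x b is the Gram determinant, so a x b is nonzero, and it is a
  multiple of \<open>n\<close>. Then \<open>v\<close> is both orthogonal and parallel to it.\<close>

lemma orthogonal_frame_zero:
  fixes a b n v :: "real^3"
  assumes "n \<bullet> n = 1" "a \<bullet> n = 0" "b \<bullet> n = 0" and G: "(a \<bullet> a) * (b \<bullet> b) - (a \<bullet> b) * (a \<bullet> b) \<noteq> 0"
    and v: "v \<bullet> a = 0" "v \<bullet> b = 0" "v \<bullet> n = 0"
  shows "v = 0"
proof -
  let ?c = "cross3 a b"
  have "?c \<bullet> ?c = (a \<bullet> a) * (b \<bullet> b) - (a \<bullet> b) * (a \<bullet> b)" by (simp add: dot_cross inner_commute)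
  then have c: "?c \<noteq> 0" using G by auto
  have "?c = (n \<bullet> ?c) *\<^sub>R n"
    using assms by (intro cross3_normal) (simp_all add: inner_commute)
  then have "v \<bullet> ?c = 0" using v(3) by (metis inner_scaleR_right mult_zero_right)
  moreover have "cross3 v ?c = 0" using v by (simp add: Lagrange)
  ultimately show ?thesis using c norm_and_cross_eq_0[of v ?c] by auto
qed

lemma orthogonal_complement_decompose:
  fixes a b n v :: "real^3"
  assumes "n \<bullet> n = 1" "a \<bullet> n = 0" "b \<bullet> n = 0" and G: "(a \<bullet> a) * (b \<bullet> b) - (a \<bullet> b) * (a \<bullet> b) \<noteq> 0"
    and "v \<bullet> n = 0"
  obtains s t where "v = s *\<^sub>R a + t *\<^sub>R b"
proof -
  define G where "G = (a \<bullet> a) * (b \<bullet> b) - (a \<bullet> b) * (a \<bullet> b)"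
  \<comment> \<open>Cramer's rule for the Gram matrix of \<open>a\<close>, \<open>b\<close>; the
    remainder is then orthogonal to the whole frame.\<close>
  define s where "s = ((v \<bullet> a) * (b \<bullet> b) - (v \<bullet> b) * (a \<bullet> b)) / G"
  define t where "t = ((v \<bullet> b) * (a \<bullet> a) - (v \<bullet> a) * (a \<bullet> b)) / G"
  have G0: "G \<noteq> 0" using assms by (simp add: G_def)
  have sG: "s * G = (v \<bullet> a) * (b \<bullet> b) - (v \<bullet> b) * (a \<bullet> b)" "t * G = (v \<bullet> b) * (a \<bullet> a) - (v \<bullet> a) * (a \<bullet> b)"
    using G0 by (simp_all add: s_def t_def)
  have "(v - (s *\<^sub>R a + t *\<^sub>R b)) \<bullet> a * G = 0" "(v - (s *\<^sub>R a + t *\<^sub>R b)) \<bullet> b * G = 0"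
    using sG unfolding G_def inner_diff_left inner_add_left inner_scaleR_left inner_commute[of b a] by algebra+
  then have "v - (s *\<^sub>R a + t *\<^sub>R b) = 0"
    using assms G0 by (intro orthogonal_frame_zero[OF assms(1-4)]) (auto simp: inner_diff_left inner_add_left)
  then show ?thesis using that by simp
qed

lemma beltrami_2:
  assumes "det (e u) \<noteq> 0"
  shows "beltrami e f u = - (1 / det (e u)) *\<^sub>R
    (e u $ 2 $ 2 *\<^sub>R cov_deriv e 1 (\<lambda>l. pd l f) 1 u - e u $ 1 $ 2 *\<^sub>R cov_deriv e 1 (\<lambda>l. pd l f) 2 u
     - e u $ 2 $ 1 *\<^sub>R cov_deriv e 2 (\<lambda>l. pd l f) 1 u + e u $ 1 $ 1 *\<^sub>R cov_deriv e 2 (\<lambda>l. pd l f) 2 u)"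
  by (simp add: beltrami_def matrix_inv_2[OF assms] sum_2 scaleR_right_distrib scaleR_right_diff_distrib)

text \<open>A covariant derivative commutes with the trace: here \<open>D\<close> is \<open>\<nabla>\<^sub>l c\<close> for the metric \<open>e\<close> and a
  symmetric tensor \<open>c\<close>, the numbers \<open>p, q, r, s\<close> are \<open>\<Gamma>\<^sup>1\<^sub>l\<^sub>1, \<Gamma>\<^sup>2\<^sub>l\<^sub>1, \<Gamma>\<^sup>1\<^sub>l\<^sub>2, \<Gamma>\<^sup>2\<^sub>l\<^sub>2\<close>, and \<open>det e\<close> times
  the trace, rather than the trace, is used to avoid divisions.\<close>

lemma cov_trace_vanishes:
  fixes e11 e12 e22 c11 c12 c22 :: real
  assumes "e22 * c11 - 2 * e12 * c12 + e11 * c22 = 0"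
    and "(de22 * c11 + e22 * dc11) - 2 * (de12 * c12 + e12 * dc12) + (de11 * c22 + e11 * dc22) = 0"
    and "de11 = 2 * (p * e11 + q * e12)"
    and "de12 = p * e12 + q * e22 + r * e11 + s * e12"
    and "de22 = 2 * (r * e12 + s * e22)"
    and "D11 = dc11 - 2 * (p * c11 + q * c12)"
    and "D12 = dc12 - (r * c11 + s * c12) - (p * c12 + q * c22)"
    and "D22 = dc22 - 2 * (r * c12 + s * c22)"
  shows "e22 * D11 - 2 * e12 * D12 + e11 * D22 = 0"
  using assms by algebra

lemma Ck_on_2_differentiable:
  assumes "open U" "Ck_on 2 U f" "u \<in> U"
  shows "f differentiable (at u)" "pd i f differentiable (at u)"
  using Ck_on_Suc_differentiable[OF assms(1), of 1 f] Ck_on_Suc_differentiable[OF assms(1), of 0 "pd i f"] assms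
  by (auto simp: numeral_2_eq_2)

section \<open>Immersed patches of the unit sphere\<close>

text \<open>The position vector is absent: \<open>m\<close> is an immersion into the unit sphere and
  III is its induced metric, so the facts below are intrinsic to the sphere.\<close>

locale gauss_image =
  fixes U :: "(real^2) set" and m :: "real^2 \<Rightarrow> real^3"
  assumes open_U: "open U" and C2: "Ck_on 2 U m"
    and unit: "\<And>u. u \<in> U \<Longrightarrow> m u \<bullet> m u = 1"
    and regular: "\<And>u. u \<in> U \<Longrightarrow> det (third_form m u) \<noteq> 0"
begin

abbreviation "\<Gamma> k i j u \<equiv> christoffel (third_form m) k i j u"

lemma diff_m:
  assumes "u \<in> U" shows "m differentiable (at u)" "pd i m differentiable (at u)"
  using Ck_on_2_differentiable[OF open_U C2 assms] by auto

lemma pd_orthogonal: "u \<in> U \<Longrightarrow> pd i m u \<bullet> m u = 0"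
  using pd_cong[OF open_U, of u "\<lambda>u. m u \<bullet> m u" "\<lambda>_. 1" i] unit
  by (simp add: pd_inner diff_m inner_commute)

lemma pd_pd_normal: "u \<in> U \<Longrightarrow> pd i (pd j m) u \<bullet> m u = - (pd i m u \<bullet> pd j m u)"
  using pd_cong[OF open_U, of u "\<lambda>u. pd j m u \<bullet> m u" "\<lambda>_. 0" i] pd_orthogonal
  by (simp add: pd_inner diff_m inner_commute)

lemma det_eq: "det (third_form m u) = (pd 1 m u \<bullet> pd 1 m u) * (pd 2 m u \<bullet> pd 2 m u) - (pd 1 m u \<bullet> pd 2 m u) * (pd 1 m u \<bullet> pd 2 m u)"
  by (simp add: det_2 third_form_def inner_commute)

lemma frame_zero:
  assumes "u \<in> U" "\<And>l. v \<bullet> pd l m u = 0" "v \<bullet> m u = 0"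
  shows "v = 0"
  using orthogonal_frame_zero[of "m u" "pd 1 m u" "pd 2 m u" v] assms unit pd_orthogonal regular[of u] det_eq
  by simp

lemma pd_third_form:
  assumes "u \<in> U"
  shows "pd l (\<lambda>v. third_form m v $ i $ j) u = pd l (pd i m) u \<bullet> pd j m u + pd i m u \<bullet> pd l (pd j m) u"
  by (simp add: third_form_def pd_inner diff_m assms)

text \<open>Expanding the three derivatives of the metric gives six inner products. By symmetry of
  second derivatives four of them cancel in pairs and the other two coincide.\<close>

lemma christoffel_eq:
  assumes "u \<in> U"
  shows "\<Gamma> k i j u = (\<Sum>l\<in>UNIV. matrix_inv (third_form m u) $ k $ l * (pd i (pd j m) u \<bullet> pd l m u))"
proof -
  have sym: "pd j (pd i m) u = pd i (pd j m) u" for i j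
    by (rule pd_commute[OF open_U assms C2])
  have "pd i (\<lambda>v. third_form m v $ j $ l) u + pd j (\<lambda>v. third_form m v $ i $ l) u - pd l (\<lambda>v. third_form m v $ i $ j) u
      = 2 * (pd i (pd j m) u \<bullet> pd l m u)" for l
    unfolding pd_third_form[OF assms] sym[of l i] sym[of l j] sym[of i j] by (simp add: inner_commute)
  then show ?thesis by (simp add: christoffel_def sum_divide_distrib)
qed

lemma christoffel_lower:
  assumes "u \<in> U"
  shows "\<Gamma> 1 i j u * (pd 1 m u \<bullet> pd l m u) + \<Gamma> 2 i j u * (pd 2 m u \<bullet> pd l m u) = pd i (pd j m) u \<bullet> pd l m u"
proof -
  let ?e = "third_form m u" and ?w = "\<lambda>l. pd i (pd j m) u \<bullet> pd l m u"
  have "\<Gamma> k i j u = matrix_inv ?e $ k $ 1 * ?w 1 + matrix_inv ?e $ k $ 2 * ?w 2" for k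
    by (simp add: christoffel_eq[OF assms] sum_2)
  then have "\<Gamma> 1 i j u = ?e $ 2 $ 2 / det ?e * ?w 1 - ?e $ 1 $ 2 / det ?e * ?w 2"
    "\<Gamma> 2 i j u = ?e $ 1 $ 1 / det ?e * ?w 2 - ?e $ 2 $ 1 / det ?e * ?w 1"
    by (simp_all add: matrix_inv_2[OF regular[OF assms]])
  \<comment> \<open>Lowering the index cancels the inverse metric; multiplying by the determinant
    clears the denominators of the adjugate formula.\<close>
  then have "det ?e * (\<Gamma> 1 i j u * ?e $ 1 $ l + \<Gamma> 2 i j u * ?e $ 2 $ l) =
      (?e $ 2 $ 2 * ?w 1 - ?e $ 1 $ 2 * ?w 2) * ?e $ 1 $ l + (?e $ 1 $ 1 * ?w 2 - ?e $ 2 $ 1 * ?w 1) * ?e $ 2 $ l"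
    using regular[OF assms] by (simp add: distrib_left right_diff_distrib left_diff_distrib)
  also have "\<dots> = det ?e * ?w l"
    using exhaust_2[of l] by (auto simp: det_2 third_form_def inner_commute algebra_simps)
  finally show ?thesis
    using regular[OF assms] by (simp add: third_form_def)
qed

text \<open>The difference of the two sides is orthogonal to the frame:
  \<open>christoffel_lower\<close> handles the tangent directions, \<open>pd_pd_normal\<close> the
  normal one.\<close>

lemma gauss_formula:
  assumes "u \<in> U"
  shows "pd i (pd j m) u = \<Gamma> 1 i j u *\<^sub>R pd 1 m u + \<Gamma> 2 i j u *\<^sub>R pd 2 m u - (pd i m u \<bullet> pd j m u) *\<^sub>R m u"
proof -
  have "pd i (pd j m) u - (\<Gamma> 1 i j u *\<^sub>R pd 1 m u + \<Gamma> 2 i j u *\<^sub>R pd 2 m u - (pd i m u \<bullet> pd j m u) *\<^sub>R m u) = 0"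
    (is "?v = 0")
  proof (rule frame_zero[OF assms])
    have "m u \<bullet> pd l m u = 0" for l using pd_orthogonal[OF assms] by (simp add: inner_commute)
    then show "?v \<bullet> pd l m u = 0" for l
      by (simp only: inner_diff_left inner_add_left inner_scaleR_left christoffel_lower[OF assms])
    show "?v \<bullet> m u = 0"
      by (simp add: inner_diff_left inner_add_left pd_orthogonal[OF assms] pd_pd_normal[OF assms] unit[OF assms])
  qed
  then show ?thesis by simp
qed

lemma christoffel_commute: "u \<in> U \<Longrightarrow> \<Gamma> k i j u = \<Gamma> k j i u"
  by (simp add: christoffel_eq pd_commute[OF open_U _ C2])

text \<open>The Christoffel terms remove the tangential part of the Gauss formula, so the second
  covariant derivative of \<open>m\<close> is minus the metric times \<open>m\<close>. The trace of
  the metric is 2.\<close>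

lemma beltrami_normal:
  assumes "u \<in> U"
  shows "beltrami (third_form m) m u = 2 *\<^sub>R m u"
proof -
  let ?e = "third_form m u"
  have "cov_deriv (third_form m) i (\<lambda>l. pd l m) j u = - (third_form m u $ i $ j) *\<^sub>R m u" for i j
    by (simp add: cov_deriv_def sum_2 gauss_formula[OF assms] third_form_def)
  then have "beltrami (third_form m) m u = (1 / det ?e * (?e $ 2 $ 2 * ?e $ 1 $ 1 - ?e $ 1 $ 2 * ?e $ 1 $ 2
      - ?e $ 2 $ 1 * ?e $ 2 $ 1 + ?e $ 1 $ 1 * ?e $ 2 $ 2)) *\<^sub>R m u"
    by (simp only: beltrami_2[of "third_form m", OF regular[OF assms]] scaleR_scaleR
        flip: scaleR_add_left scaleR_diff_left) (simp add: algebra_simps)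
  also have "?e $ 2 $ 2 * ?e $ 1 $ 1 - ?e $ 1 $ 2 * ?e $ 1 $ 2 - ?e $ 2 $ 1 * ?e $ 2 $ 1 + ?e $ 1 $ 1 * ?e $ 2 $ 2
      = 2 * det ?e"
    by (simp add: det_2 third_form_def inner_commute)
  finally show ?thesis
    using regular[OF assms] by simp
qed

lemma beltrami_scaleR:
  assumes "Ck_on 2 U f" "u \<in> U"
  shows "beltrami (third_form m) (\<lambda>u. c *\<^sub>R f u) u = c *\<^sub>R beltrami (third_form m) f u"
proof -
  have 1: "pd l (\<lambda>u. c *\<^sub>R f u) v = c *\<^sub>R pd l f v" if "v \<in> U" for l v
    by (rule pd_scaleR[OF Ck_on_2_differentiable(1)[OF open_U assms(1) that]])
  have 2: "pd k (pd l (\<lambda>u. c *\<^sub>R f u)) u = c *\<^sub>R pd k (pd l f) u" for k l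
    using pd_cong[OF open_U assms(2), of "pd l (\<lambda>u. c *\<^sub>R f u)" "\<lambda>v. c *\<^sub>R pd l f v"] 1
      pd_scaleR[OF Ck_on_2_differentiable(2)[OF open_U assms]] by simp
  show ?thesis
    unfolding beltrami_def cov_deriv_def 2 1[OF assms(2)]
    by (simp add: sum_2 algebra_simps)
qed

text \<open>Hypothesis \<open>trace\<close> is the vanishing of the III-trace of \<open>c\<close>,
  multiplied by the determinant of III; its two mixed terms are merged, as \<open>c\<close> is
  symmetric.\<close>

lemma beltrami_zero:
  assumes y: "Ck_on 2 U y"
    and tangent: "\<And>u i. u \<in> U \<Longrightarrow> pd i y u \<bullet> m u = 0"
    and trace: "\<And>u. u \<in> U \<Longrightarrow> third_form m u $ 2 $ 2 * (pd 1 y u \<bullet> pd 1 m u)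
        - 2 * third_form m u $ 1 $ 2 * (pd 1 y u \<bullet> pd 2 m u) + third_form m u $ 1 $ 1 * (pd 2 y u \<bullet> pd 2 m u) = 0"
    and u: "u \<in> U"
  shows "beltrami (third_form m) y u = 0"
proof -
  define e where "e i j v = third_form m v $ i $ j" for i j v
  define c where "c i j v = pd i y v \<bullet> pd j m v" for i j v
  define C where "C i j = cov_deriv (third_form m) i (\<lambda>l. pd l y) j u" for i j
  define D where "D i j l = C i j \<bullet> pd l m u" for i j l
  note dy = Ck_on_2_differentiable[OF open_U y]
  have e_sym: "e i j = e j i" for i j by (auto simp: e_def third_form_def inner_commute)
  \<comment> \<open>Differentiating the tangency of \<open>y\<close>. Since second derivatives of
    \<open>y\<close> commute, this yields the symmetry of \<open>c\<close>.\<close>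
  have y_normal: "pd i (pd j y) v \<bullet> m v = - c j i v" if "v \<in> U" for i j v
    using pd_cong[OF open_U that, of "\<lambda>u. pd j y u \<bullet> m u" "\<lambda>_. 0" i] tangent that
    by (simp add: pd_inner diff_m dy c_def)
  have c_sym: "c i j v = c j i v" if "v \<in> U" for i j v
    using y_normal[OF that, of i j] y_normal[OF that, of j i] pd_commute[OF open_U that y, of i j] by simp
  have de: "pd l (e i j) u = \<Gamma> 1 l i u * e 1 j u + \<Gamma> 2 l i u * e 2 j u + (\<Gamma> 1 l j u * e 1 i u + \<Gamma> 2 l j u * e 2 i u)" for i j l
    unfolding e_def pd_third_form[OF u] christoffel_lower[OF u, symmetric] inner_commute[of "pd i m u" "pd l (pd j m) u"]
    by (simp add: third_form_def)
  have dc: "pd i (c j l) u = pd i (pd j y) u \<bullet> pd l m u + (\<Gamma> 1 i l u * c j 1 u + \<Gamma> 2 i l u * c j 2 u)" for i j l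
    unfolding c_def using tangent[OF u]
    by (simp add: pd_inner diff_m dy u gauss_formula inner_diff_right inner_add_right)
  \<comment> \<open>\<open>D\<close> pairs the second covariant derivative of \<open>y\<close> with
    the frame. By \<open>dc\<close> this is the full covariant derivative of the tensor
    \<open>c\<close>: the normal part in the Gauss formula drops out against the tangent vectors
    \<open>pd j y\<close>.\<close>
  have D: "D i j l = pd i (c j l) u - (\<Gamma> 1 i l u * c j 1 u + \<Gamma> 2 i l u * c j 2 u) - (\<Gamma> 1 i j u * c 1 l u + \<Gamma> 2 i j u * c 2 l u)" for i j l
    unfolding dc by (simp add: D_def C_def cov_deriv_def sum_2 inner_diff_left inner_add_left c_def)
  \<comment> \<open>\<open>D i j l\<close> is \<open>\<nabla>\<^sub>i c\<^sub>j\<^sub>l\<close>; its total symmetry is the Codazzi equation, and turns the divergence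
    of \<open>c\<close> into the gradient of its trace.\<close>
  have D1: "D i j l = D j i l" for i j l
    unfolding D_def C_def cov_deriv_def
    using pd_commute[OF open_U u y, of i j] christoffel_commute[OF u, of _ i j] by simp
  have D2: "D i j l = D i l j" for i j l
  proof -
    have "pd i (c j l) u = pd i (c l j) u" by (rule pd_cong[OF open_U u c_sym])
    moreover have "c j k u = c k j u" "c k l u = c l k u" for k by (rule c_sym[OF u])+
    ultimately show ?thesis unfolding D by simp
  qed
  have diff_e: "e i j differentiable (at u)" for i j
    unfolding e_def third_form_def using diff_m[OF u] by simp
  have diff_c: "c i j differentiable (at u)" for i j
    unfolding c_def using diff_m[OF u] dy[OF u] by simp
  have tr: "e 2 2 v * c 1 1 v - 2 * e 1 2 v * c 1 2 v + e 1 1 v * c 2 2 v = 0" if "v \<in> U" for v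
    using trace[OF that] by (simp add: e_def c_def)
  have dtr: "(pd l (e 2 2) u * c 1 1 u + e 2 2 u * pd l (c 1 1) u) - 2 * (pd l (e 1 2) u * c 1 2 u + e 1 2 u * pd l (c 1 2) u)
      + (pd l (e 1 1) u * c 2 2 u + e 1 1 u * pd l (c 2 2) u) = 0" for l
  proof -
    have "((\<lambda>v. e 2 2 v * c 1 1 v - 2 * (e 1 2 v * c 1 2 v) + e 1 1 v * c 2 2 v) has_derivative
      (\<lambda>h. (e 2 2 u * frechet_derivative (c 1 1) (at u) h + frechet_derivative (e 2 2) (at u) h * c 1 1 u)
         - 2 * (e 1 2 u * frechet_derivative (c 1 2) (at u) h + frechet_derivative (e 1 2) (at u) h * c 1 2 u)
         + (e 1 1 u * frechet_derivative (c 2 2) (at u) h + frechet_derivative (e 1 1) (at u) h * c 2 2 u))) (at u)"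
      by (intro has_derivative_add has_derivative_diff has_derivative_mult_right has_derivative_mult has_derivative_pd diff_e diff_c)
    from pd_eqI[OF this, of l] pd_cong[OF open_U u, of "\<lambda>v. e 2 2 v * c 1 1 v - 2 * (e 1 2 v * c 1 2 v) + e 1 1 v * c 2 2 v" "\<lambda>_. 0" l] tr
    show ?thesis by (simp add: pd_def algebra_simps)
  qed
  \<comment> \<open>By \<open>beltrami_2\<close>, \<open>T\<close> is the Beltrami operator of
    \<open>y\<close> times minus the determinant of III. Its tangential part gives the derivative of
    the trace, its normal part the trace itself.\<close>
  define T where "T = e 2 2 u *\<^sub>R C 1 1 - e 1 2 u *\<^sub>R C 1 2 - e 2 1 u *\<^sub>R C 2 1 + e 1 1 u *\<^sub>R C 2 2"
  have "T = 0"
  proof (rule frame_zero[OF u])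
    fix l :: 2
    have "e 2 2 u * D l 1 1 - 2 * e 1 2 u * D l 1 2 + e 1 1 u * D l 2 2 = 0"
      by (rule cov_trace_vanishes[OF tr[OF u] dtr[of l], of "\<Gamma> 1 l 1 u" "\<Gamma> 2 l 1 u" "\<Gamma> 1 l 2 u" "\<Gamma> 2 l 2 u"])
        (simp_all add: de D e_sym[of 2 1] c_sym[OF u, of 2 1])
    moreover have "D 1 1 l = D l 1 1" "D 2 2 l = D l 2 2" "D 1 2 l = D l 1 2" "D 2 1 l = D l 1 2"
      by (metis D1 D2)+
    ultimately show "T \<bullet> pd l m u = 0"
      by (simp add: T_def inner_diff_left inner_add_left e_sym[of 2 1] mult.commute flip: D_def)
  next
    have "C i j \<bullet> m u = - c j i u" for i j
      using tangent[OF u] y_normal[OF u] by (simp add: C_def cov_deriv_def sum_2 inner_diff_left inner_add_left)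
    then show "T \<bullet> m u = 0"
      using tr[OF u] by (simp add: T_def inner_diff_left inner_add_left e_sym[of 2 1] c_sym[OF u, of 2 1] mult.commute)
  qed
  then show ?thesis
    by (simp add: beltrami_2[of "third_form m", OF regular[OF u]] T_def C_def e_def)
qed

end

section \<open>Surfaces with constant curvature ratio\<close>

lemma bounded_bilinear_cross3: "bounded_bilinear cross3"
  unfolding bilinear_conv_bounded_bilinear[symmetric] bilinear_def
  by (auto intro!: linearI simp: cross_add_left cross_add_right cross_mult_left cross_mult_right)

lemma Ck_on_derivative_zero:
  assumes "open U" and s: "\<And>u. u \<in> U \<Longrightarrow> (s has_derivative (\<lambda>_. 0)) (at u)"
  shows "Ck_on k U s"
proof -
  have d: "s differentiable_on U"
    using s by (force simp: differentiable_on_eq_differentiable_at[OF assms(1)] differentiable_def)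
  show ?thesis
  proof (cases k)
    case 0
    then show ?thesis using d by (simp add: differentiable_imp_continuous_on)
  next
    case (Suc l)
    have "Ck_on l U (pd i s)" for i
      by (rule Ck_on_cong[OF assms(1) _ Ck_on_const[of l U 0]]) (simp add: pd_eqI[OF s])
    then show ?thesis using Suc d by simp
  qed
qed

lemma has_derivative_zero_of_sign:
  fixes s :: "real^2 \<Rightarrow> real"
  assumes "open U" "continuous_on U s" "\<And>u. u \<in> U \<Longrightarrow> s u * s u = 1" "u \<in> U"
  shows "(s has_derivative (\<lambda>_. 0)) (at u)"
proof -
  \<comment> \<open>The values of \<open>s\<close> are 1 and -1, at distance 2, so a variation below
    1 forces equality. \<open>U\<close> may be disconnected, hence only local constancy.\<close>
  obtain d where d: "d > 0" "\<And>v. \<lbrakk>v \<in> U; dist v u < d\<rbrakk> \<Longrightarrow> dist (s v) (s u) < 1"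
    using assms(2,4) unfolding continuous_on_iff by (metis zero_less_one)
  have "s u = s v" if "v \<in> U \<inter> ball u d" for v
  proof -
    have "s u = 1 \<or> s u = -1" "s v = 1 \<or> s v = -1"
      using assms(3)[of u] assms(3)[of v] assms(4) that by (auto simp: square_eq_1_iff)
    moreover have "dist (s v) (s u) < 1" using that d(2)[of v] by (auto simp: dist_commute)
    ultimately show ?thesis by (auto simp: dist_real_def)
  qed
  then show ?thesis
    using assms d(1) by (intro has_derivative_transform_within_open[OF has_derivative_const[of "s u"], of "U \<inter> ball u d"]) auto
qed

text \<open>The normal is assumed continuous only. It equals \<open>s\<close> times the normalised
  cross product \<open>N\<close>, which is C^2 because \<open>x\<close> is C^3, and the continuous
  sign \<open>s\<close> is locally constant.\<close>

lemma unit_normal_C2: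
  fixes x m :: "real^2 \<Rightarrow> real^3"
  assumes U: "open U" and x: "Ck_on 3 U x" and m: "continuous_on U m"
    and unit: "\<And>u. u \<in> U \<Longrightarrow> m u \<bullet> m u = 1"
    and orth: "\<And>u i. u \<in> U \<Longrightarrow> m u \<bullet> pd i x u = 0"
    and reg: "\<And>u. u \<in> U \<Longrightarrow> det (first_form x u) \<noteq> 0"
  shows "Ck_on 2 U m"
proof -
  define c where "c u = cross3 (pd 1 x u) (pd 2 x u)" for u
  define N where "N u = (1 / sqrt (c u \<bullet> c u)) *\<^sub>R c u" for u
  define s where "s u = m u \<bullet> N u" for u
  have "Ck_on 2 U (pd i x)" for i using x by (simp add: numeral_3_eq_3 numeral_2_eq_2)
  then have c: "Ck_on 2 U c"
    unfolding c_def by (intro Ck_on_bilinear[OF bounded_bilinear_cross3 U])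
  have c_pos: "c u \<bullet> c u > 0" if "u \<in> U" for u
  proof -
    have "c u \<bullet> c u = det (first_form x u)"
      by (simp add: c_def dot_cross det_2 first_form_def)
    then have "c u \<noteq> 0" using reg[OF that] by auto
    then show ?thesis by simp
  qed
  have N: "Ck_on 2 U N"
    unfolding N_def by (intro Ck_on_scaleR[OF U] Ck_on_inverse_sqrt[OF U] Ck_on_inner[OF U] c c_pos)
  have c_m: "c u = (m u \<bullet> c u) *\<^sub>R m u" if "u \<in> U" for u
    unfolding c_def using cross3_normal[OF unit[OF that] orth[OF that] orth[OF that]] .
  have c_c: "c u \<bullet> c u = (m u \<bullet> c u) * (m u \<bullet> c u)" if "u \<in> U" for u
    using arg_cong[OF c_m[OF that], of "\<lambda>v. v \<bullet> c u"] by simp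
  have s: "s u * s u = 1" if "u \<in> U" for u
  proof -
    have "s u * s u = (m u \<bullet> c u) * (m u \<bullet> c u) / (sqrt (c u \<bullet> c u) * sqrt (c u \<bullet> c u))"
      by (simp add: s_def N_def)
    then show ?thesis using c_pos[OF that] by (simp flip: c_c[OF that])
  qed
  have m_eq: "s u *\<^sub>R N u = m u" if "u \<in> U" for u
  proof -
    have "s u *\<^sub>R N u = ((m u \<bullet> c u) / (c u \<bullet> c u)) *\<^sub>R c u"
      using c_pos[OF that] by (simp add: s_def N_def field_simps)
    also have "\<dots> = ((m u \<bullet> c u) / (c u \<bullet> c u)) *\<^sub>R ((m u \<bullet> c u) *\<^sub>R m u)"
      using c_m[OF that] by simp
    also have "\<dots> = m u" using c_pos[OF that] by (simp flip: c_c[OF that])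
    finally show ?thesis .
  qed
  have "continuous_on U N" using Ck_on_SucD[of 0 U N] Ck_on_SucD[of 1 U N] N by (simp add: numeral_2_eq_2)
  then have "continuous_on U s" unfolding s_def by (intro continuous_on_inner m)
  then have "Ck_on 2 U s"
    using has_derivative_zero_of_sign[OF U _ s] by (intro Ck_on_derivative_zero[OF U])
  then show ?thesis
    using Ck_on_cong[OF U m_eq Ck_on_scaleR[OF U _ N]] by blast
qed

section \<open>From the curvature ratio to harmonicity\<close>

text \<open>Here \<open>a\<close>, \<open>b\<close> are the derivatives of \<open>x\<close> and
  \<open>p\<close>, \<open>q\<close> those of \<open>n\<close>; hypothesis \<open>H\<close> is H =
  \<mu> K with denominators cleared. Express \<open>p\<close>, \<open>q\<close> through
  \<open>a\<close>, \<open>b\<close> by a matrix with determinant \<open>d\<close> and trace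
  \<open>s + w\<close>. For the Gram determinant G of \<open>a\<close>, \<open>b\<close>, the
  determinants of II and III are d G and d^2 G, and \<open>H\<close> says
  \<open>s + w = - 2 * \<mu> * d\<close>. The trace expression formed with III is (s + w) d
  G.\<close>

lemma weingarten_trace:
  fixes a b n p q :: "real^3" and \<mu> :: real
  assumes "n \<bullet> n = 1" "a \<bullet> n = 0" "b \<bullet> n = 0" "p \<bullet> n = 0" "q \<bullet> n = 0"
    and G: "(a \<bullet> a) * (b \<bullet> b) - (a \<bullet> b) * (a \<bullet> b) \<noteq> 0"
    and B: "(a \<bullet> p) * (b \<bullet> q) - (a \<bullet> q) * (b \<bullet> p) \<noteq> 0"
    and H: "(b \<bullet> b) * (a \<bullet> p) - (a \<bullet> b) * (a \<bullet> q) - (a \<bullet> b) * (b \<bullet> p) + (a \<bullet> a) * (b \<bullet> q)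
      = - 2 * \<mu> * ((a \<bullet> p) * (b \<bullet> q) - (a \<bullet> q) * (b \<bullet> p))"
  shows "(p \<bullet> p) * (q \<bullet> q) - (p \<bullet> q) * (p \<bullet> q) \<noteq> 0"
    and "(q \<bullet> q) * (a \<bullet> p) - (p \<bullet> q) * (a \<bullet> q) - (p \<bullet> q) * (b \<bullet> p) + (p \<bullet> p) * (b \<bullet> q)
      = - 2 * \<mu> * ((p \<bullet> p) * (q \<bullet> q) - (p \<bullet> q) * (p \<bullet> q))"
proof -
  obtain s t where p: "p = s *\<^sub>R a + t *\<^sub>R b"
    using orthogonal_complement_decompose[OF assms(1-3) G assms(4)] .
  obtain v w where q: "q = v *\<^sub>R a + w *\<^sub>R b"
    using orthogonal_complement_decompose[OF assms(1-3) G assms(5)] .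
  define A C E where "A = a \<bullet> a" and "C = a \<bullet> b" and "E = b \<bullet> b"
  define d where "d = s * w - t * v"
  have ab: "a \<bullet> p = s * A + t * C" "b \<bullet> p = s * C + t * E" "a \<bullet> q = v * A + w * C" "b \<bullet> q = v * C + w * E"
    by (simp_all add: p q A_def C_def E_def inner_add_right inner_commute)
  have "p \<bullet> p = s * (a \<bullet> p) + t * (b \<bullet> p)" "q \<bullet> q = v * (a \<bullet> q) + w * (b \<bullet> q)" "p \<bullet> q = s * (a \<bullet> q) + t * (b \<bullet> q)"
    by (subst (1) p q, simp add: inner_add_left)+
  note e = this[unfolded ab]
  have G': "A * E - C * C \<noteq> 0" using G by (simp add: A_def C_def E_def)
  have detB: "(a \<bullet> p) * (b \<bullet> q) - (a \<bullet> q) * (b \<bullet> p) = d * (A * E - C * C)"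
    unfolding ab d_def by algebra
  have dete: "(p \<bullet> p) * (q \<bullet> q) - (p \<bullet> q) * (p \<bullet> q) = d * d * (A * E - C * C)"
    unfolding e d_def by algebra
  have d0: "d \<noteq> 0" using B detB by auto
  show "(p \<bullet> p) * (q \<bullet> q) - (p \<bullet> q) * (p \<bullet> q) \<noteq> 0"
    using dete d0 G' by simp
  have "(s + w) * (A * E - C * C) = - 2 * \<mu> * d * (A * E - C * C)"
    using H unfolding detB unfolding ab A_def[symmetric] C_def[symmetric] E_def[symmetric] by algebra
  then have sw: "s + w = - 2 * \<mu> * d" using mult_right_cancel[OF G'] by blast
  have "(q \<bullet> q) * (a \<bullet> p) - (p \<bullet> q) * (a \<bullet> q) - (p \<bullet> q) * (b \<bullet> p) + (p \<bullet> p) * (b \<bullet> q) = (s + w) * d * (A * E - C * C)"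
    unfolding e ab d_def by algebra
  then show "(q \<bullet> q) * (a \<bullet> p) - (p \<bullet> q) * (a \<bullet> q) - (p \<bullet> q) * (b \<bullet> p) + (p \<bullet> p) * (b \<bullet> q)
      = - 2 * \<mu> * ((p \<bullet> p) * (q \<bullet> q) - (p \<bullet> q) * (p \<bullet> q))"
    unfolding sw dete by simp
qed

lemma Ck_on_3_imp_2: "Ck_on 3 U f \<Longrightarrow> Ck_on 2 U f"
  using Ck_on_SucD[of 2 U f] by (simp add: numeral_3_eq_3 numeral_2_eq_2)

lemma curvature_patch:
  fixes x m :: "real^2 \<Rightarrow> real^3"
  assumes U: "open U" and x: "Ck_on 3 U x" and m: "continuous_on U m"
    and unit: "\<And>u. u \<in> U \<Longrightarrow> m u \<bullet> m u = 1"
    and orth: "\<And>u i. u \<in> U \<Longrightarrow> m u \<bullet> pd i x u = 0"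
    and K: "\<And>u. u \<in> U \<Longrightarrow> gauss_curv x m u \<noteq> 0"
    and HK: "\<And>u. u \<in> U \<Longrightarrow> mean_curv x m u / gauss_curv x m u = \<mu>"
  shows "gauss_image U m"
    and "\<And>u. u \<in> U \<Longrightarrow> beltrami (third_form m) (\<lambda>u. x u + \<mu> *\<^sub>R m u) u = 0"
proof -
  have reg: "det (first_form x u) \<noteq> 0" "det (second_form x m u) \<noteq> 0" if "u \<in> U" for u
    using K[OF that] by (auto simp: gauss_curv_def)
  have C2m: "Ck_on 2 U m" using unit_normal_C2[OF U x m unit orth reg(1)] .
  note C2x = Ck_on_3_imp_2[OF x]
  note dm = Ck_on_2_differentiable[OF U C2m] and dx = Ck_on_2_differentiable[OF U C2x]
  have n_orth: "pd i m u \<bullet> m u = 0" if "u \<in> U" for u i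
    using pd_cong[OF U that, of "\<lambda>u. m u \<bullet> m u" "\<lambda>_. 1" i] unit that
    by (simp add: pd_inner dm inner_commute)
  have b: "second_form x m u $ i $ j = - (pd i x u \<bullet> pd j m u)" if "u \<in> U" for u i j
    using pd_cong[OF U that, of "\<lambda>u. pd i x u \<bullet> m u" "\<lambda>_. 0" j] orth that
    by (simp add: second_form_def pd_inner dm dx inner_commute)
  have e: "third_form m u $ i $ j = pd i m u \<bullet> pd j m u" for u i j
    by (simp add: third_form_def)
  \<comment> \<open>The products of derivatives of \<open>x\<close> and \<open>m\<close> are the
    entries of -II, so this says that the III-trace of II is 2 \<mu>.\<close>
  have wt: "det (third_form m u) \<noteq> 0 \<and>
      third_form m u $ 2 $ 2 * (pd 1 x u \<bullet> pd 1 m u) - third_form m u $ 1 $ 2 * (pd 1 x u \<bullet> pd 2 m u)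
      - third_form m u $ 1 $ 2 * (pd 2 x u \<bullet> pd 1 m u) + third_form m u $ 1 $ 1 * (pd 2 x u \<bullet> pd 2 m u)
      = - 2 * \<mu> * det (third_form m u)" if u: "u \<in> U" for u
  proof -
    let ?g = "first_form x u" and ?b = "second_form x m u"
    have "mean_curv x m u = (?g $ 2 $ 2 * ?b $ 1 $ 1 - ?g $ 1 $ 2 * ?b $ 1 $ 2 - ?g $ 2 $ 1 * ?b $ 2 $ 1 + ?g $ 1 $ 1 * ?b $ 2 $ 2) / (2 * det ?g)"
      by (simp add: mean_curv_def matrix_inv_2[OF reg(1)[OF u]] sum_2 add_divide_distrib diff_divide_distrib)
    then have "?g $ 2 $ 2 * ?b $ 1 $ 1 - ?g $ 1 $ 2 * ?b $ 1 $ 2 - ?g $ 2 $ 1 * ?b $ 2 $ 1 + ?g $ 1 $ 1 * ?b $ 2 $ 2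
        = 2 * mean_curv x m u * det ?g"
      using reg(1)[OF u] by simp
    also have "mean_curv x m u = \<mu> * gauss_curv x m u"
      using HK[OF u] K[OF u] by (simp add: divide_eq_eq)
    also have "2 * (\<mu> * gauss_curv x m u) * det ?g = 2 * \<mu> * det ?b"
      using reg(1)[OF u] by (simp add: gauss_curv_def)
    finally have H: "?g $ 2 $ 2 * ?b $ 1 $ 1 - ?g $ 1 $ 2 * ?b $ 1 $ 2 - ?g $ 2 $ 1 * ?b $ 2 $ 1 + ?g $ 1 $ 1 * ?b $ 2 $ 2
        = 2 * \<mu> * det ?b" .
    have tan: "pd i x u \<bullet> m u = 0" for i using orth[OF u] by (simp add: inner_commute)
    have "(pd 1 x u \<bullet> pd 1 x u) * (pd 2 x u \<bullet> pd 2 x u) - (pd 1 x u \<bullet> pd 2 x u) * (pd 1 x u \<bullet> pd 2 x u) \<noteq> 0"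
      using reg(1)[OF u] by (simp add: det_2 first_form_def inner_commute)
    moreover have "(pd 1 x u \<bullet> pd 1 m u) * (pd 2 x u \<bullet> pd 2 m u) - (pd 1 x u \<bullet> pd 2 m u) * (pd 2 x u \<bullet> pd 1 m u) \<noteq> 0"
      using reg(2)[OF u] by (simp add: det_2 b[OF u])
    moreover have "(pd 2 x u \<bullet> pd 2 x u) * (pd 1 x u \<bullet> pd 1 m u) - (pd 1 x u \<bullet> pd 2 x u) * (pd 1 x u \<bullet> pd 2 m u)
        - (pd 1 x u \<bullet> pd 2 x u) * (pd 2 x u \<bullet> pd 1 m u) + (pd 1 x u \<bullet> pd 1 x u) * (pd 2 x u \<bullet> pd 2 m u)
      = - 2 * \<mu> * ((pd 1 x u \<bullet> pd 1 m u) * (pd 2 x u \<bullet> pd 2 m u) - (pd 1 x u \<bullet> pd 2 m u) * (pd 2 x u \<bullet> pd 1 m u))"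
      using H unfolding det_2 b[OF u] first_form_def vec_lambda_beta inner_commute[of "pd 2 x u" "pd 1 x u"] by algebra
    ultimately show ?thesis
      using weingarten_trace[OF unit[OF u] tan tan n_orth[OF u] n_orth[OF u]]
      by (simp add: det_2 e inner_commute[of "pd 2 m u" "pd 1 m u"])
  qed
  show G: "gauss_image U m"
    using U C2m unit wt by unfold_locales auto
  interpret gauss_image U m by (rule G)
  show "beltrami (third_form m) (\<lambda>u. x u + \<mu> *\<^sub>R m u) u = 0" if "u \<in> U" for u
  proof (rule beltrami_zero[OF _ _ _ that])
    show "Ck_on 2 U (\<lambda>u. x u + \<mu> *\<^sub>R m u)"
      by (intro Ck_on_add[OF U] Ck_on_scaleR[OF U] C2x C2m Ck_on_const)
    have pd_y: "pd i (\<lambda>u. x u + \<mu> *\<^sub>R m u) u = pd i x u + \<mu> *\<^sub>R pd i m u" if "u \<in> U" for u i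
      using dm[OF that] dx[OF that] by (simp add: pd_add pd_scaleR)
    show "pd i (\<lambda>u. x u + \<mu> *\<^sub>R m u) u \<bullet> m u = 0" if "u \<in> U" for u i
      using orth[OF that] n_orth[OF that] by (simp add: pd_y[OF that] inner_add_left inner_commute[of "pd i x u"])
    show "third_form m u $ 2 $ 2 * (pd 1 (\<lambda>u. x u + \<mu> *\<^sub>R m u) u \<bullet> pd 1 m u)
        - 2 * third_form m u $ 1 $ 2 * (pd 1 (\<lambda>u. x u + \<mu> *\<^sub>R m u) u \<bullet> pd 2 m u)
        + third_form m u $ 1 $ 1 * (pd 2 (\<lambda>u. x u + \<mu> *\<^sub>R m u) u \<bullet> pd 2 m u) = 0" if u: "u \<in> U" for u
    proof -
      \<comment> \<open>Symmetry of II merges the two mixed terms into the shape required by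
        \<open>beltrami_zero\<close>.\<close>
      have sym: "pd 2 x u \<bullet> pd 1 m u = pd 1 x u \<bullet> pd 2 m u"
        using b[OF u, of 1 2] b[OF u, of 2 1] pd_commute[OF U u C2x, of 1 2]
        by (simp add: second_form_def)
      show ?thesis
        using wt[OF u] unfolding pd_y[OF u] det_2 e sym inner_add_left inner_scaleR_left
          inner_commute[of "pd 2 m u" "pd 1 m u"] by algebra
    qed
  qed
qed

lemma gauss_image_local_param:
  assumes "gauss_map M X n" "no_parabolic_points M X n" "curv_ratio_const M X n \<mu>"
    and p: "local_param M X U \<phi>"
  shows "gauss_image U (n \<circ> \<phi>)" "Ck_on 2 U (X \<circ> \<phi>)"
    and "\<And>u. u \<in> U \<Longrightarrow> beltrami (third_form (n \<circ> \<phi>)) (\<lambda>u. (X \<circ> \<phi>) u + \<mu> *\<^sub>R (n \<circ> \<phi>) u) u = 0"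
proof -
  have U: "open U" and C3: "Ck_on 3 U (X \<circ> \<phi>)" and sub: "\<phi> ` U \<subseteq> M"
    using p by (auto simp: local_param_def dest: openin_imp_subset)
  have "continuous_on U \<phi>" using p by (auto simp: local_param_def homeomorphism_def)
  moreover have "continuous_on M n" using assms(1) by (simp add: gauss_map_def)
  ultimately have cont: "continuous_on U (n \<circ> \<phi>)"
    using sub by (meson continuous_on_compose continuous_on_subset)
  have unit: "(n \<circ> \<phi>) u \<bullet> (n \<circ> \<phi>) u = 1" if "u \<in> U" for u
    using assms(1) sub that by (fastforce simp: gauss_map_def dot_square_norm)
  have orth: "(n \<circ> \<phi>) u \<bullet> pd i (X \<circ> \<phi>) u = 0" if "u \<in> U" for u i
    using assms(1) p that by (simp add: gauss_map_def)
  have K: "gauss_curv (X \<circ> \<phi>) (n \<circ> \<phi>) u \<noteq> 0"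
    and HK: "mean_curv (X \<circ> \<phi>) (n \<circ> \<phi>) u / gauss_curv (X \<circ> \<phi>) (n \<circ> \<phi>) u = \<mu>" if "u \<in> U" for u
    using assms p that by (auto simp: no_parabolic_points_def curv_ratio_const_def)
  show "gauss_image U (n \<circ> \<phi>)"
    by (rule curvature_patch(1)[OF U C3 cont unit orth K HK])
  show "beltrami (third_form (n \<circ> \<phi>)) (\<lambda>u. (X \<circ> \<phi>) u + \<mu> *\<^sub>R (n \<circ> \<phi>) u) u = 0" if "u \<in> U" for u
    by (rule curvature_patch(2)[OF U C3 cont unit orth K HK that])
  show "Ck_on 2 U (X \<circ> \<phi>)" by (rule Ck_on_3_imp_2[OF C3])
qed

theorem theorem4p4:
  fixes M :: "'a::t2_space set" and X n :: "'a \<Rightarrow> real^3" and \<mu> :: real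
  assumes "surface M X" and "connected M"
    and "gauss_map M X n"
    and "no_parabolic_points M X n"
    and "curv_ratio_const M X n \<mu>" and "\<mu> \<noteq> 0"
    and "\<not> part_of_sphere M X"
  shows "null_III_type M X n 2"
proof -
  note chart = gauss_image_local_param[OF assms(3-5)]
  define f1 where "f1 p = X p + \<mu> *\<^sub>R n p" for p
  define f2 where "f2 p = (- \<mu>) *\<^sub>R n p" for p
  have "III_eigen M X n 0 f1"
    unfolding III_eigen_def
  proof (intro allI impI conjI ballI)
    fix U \<phi> assume p: "local_param M X U \<phi>"
    interpret gauss_image U "n \<circ> \<phi>" by (rule chart(1)[OF p])
    have eq: "f1 \<circ> \<phi> = (\<lambda>u. (X \<circ> \<phi>) u + \<mu> *\<^sub>R (n \<circ> \<phi>) u)" by (auto simp: f1_def)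
    show "Ck_on 2 U (f1 \<circ> \<phi>)"
      unfolding eq by (intro Ck_on_add Ck_on_scaleR Ck_on_const open_U C2 chart(2)[OF p])
    show "beltrami (third_form (n \<circ> \<phi>)) (f1 \<circ> \<phi>) u = 0 *\<^sub>R f1 (\<phi> u)" if "u \<in> U" for u
      unfolding eq using chart(3)[OF p that] by simp
  qed
  moreover have "III_eigen M X n 2 f2"
    unfolding III_eigen_def
  proof (intro allI impI conjI ballI)
    fix U \<phi> assume p: "local_param M X U \<phi>"
    interpret gauss_image U "n \<circ> \<phi>" by (rule chart(1)[OF p])
    have eq: "f2 \<circ> \<phi> = (\<lambda>u. (- \<mu>) *\<^sub>R (n \<circ> \<phi>) u)" by (auto simp: f2_def)
    show "Ck_on 2 U (f2 \<circ> \<phi>)"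
      unfolding eq by (intro Ck_on_scaleR Ck_on_const open_U C2)
    show "beltrami (third_form (n \<circ> \<phi>)) (f2 \<circ> \<phi>) u = 2 *\<^sub>R f2 (\<phi> u)" if "u \<in> U" for u
      unfolding eq beltrami_scaleR[OF C2 that] beltrami_normal[OF that] by (simp add: f2_def)
  qed
  moreover have "\<not> f1 constant_on M"
  proof
    assume "f1 constant_on M"
    then obtain a where a: "\<And>p. p \<in> M \<Longrightarrow> X p + \<mu> *\<^sub>R n p = a"
      by (auto simp: constant_on_def f1_def)
    \<comment> \<open>If the harmonic part were a constant \<open>a\<close>, then
      \<open>a - X p\<close> would be \<mu> times a unit vector.\<close>
    have "dist a (X p) = \<bar>\<mu>\<bar>" if "p \<in> M" for p
    proof -
      have "norm (n p) = 1" using assms(3) that by (auto simp: gauss_map_def)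
      then show ?thesis using a[OF that] by (auto simp: dist_norm)
    qed
    then have "part_of_sphere M X"
      using assms(6) unfolding part_of_sphere_def by (intro exI[of _ a] exI[of _ "\<bar>\<mu>\<bar>"]) auto
    then show False using assms(7) by simp
  qed
  moreover have "\<not> f2 constant_on M"
  proof
    assume "f2 constant_on M"
    then obtain a where "\<And>p. p \<in> M \<Longrightarrow> (- \<mu>) *\<^sub>R n p = a"
      by (auto simp: constant_on_def f2_def)
    then have a: "n p = (- 1 / \<mu>) *\<^sub>R a" if "p \<in> M" for p
      using assms(6) that by force
    \<comment> \<open>A point is needed to contradict regularity; the empty set lies on every
      sphere, so it is excluded by hypothesis.\<close>
    have "M \<noteq> {}"
    proof
      assume "M = {}"
      then have "part_of_sphere M X" by (auto simp: part_of_sphere_def intro: exI[of _ 1])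
      then show False using assms(7) by simp
    qed
    then obtain U \<phi> u where p: "local_param M X U \<phi>" and u: "u \<in> U"
      using assms(1) unfolding surface_def by blast
    interpret gauss_image U "n \<circ> \<phi>" by (rule chart(1)[OF p])
    have "\<phi> v \<in> M" if "v \<in> U" for v
      using p that by (auto simp: local_param_def dest: openin_imp_subset)
    \<comment> \<open>A constant normal would make III vanish, against its nondegeneracy.\<close>
    then have "pd i (n \<circ> \<phi>) u = 0" for i
      using pd_cong[OF open_U u, of "n \<circ> \<phi>" "\<lambda>_. (- 1 / \<mu>) *\<^sub>R a" i] a by simp
    then show False using regular[OF u] by (simp add: det_eq)
  qed
  ultimately have "III_decomposition M X n 2 0 (\<lambda>i. if i = 1 then f1 else f2) (\<lambda>i. if i = 1 then 0 else 2)"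
    by (auto simp: III_decomposition_def numeral_2_eq_2 inj_on_def atLeastAtMostSuc_conv f1_def f2_def)
  moreover have "\<exists>i\<in>{1..2::nat}. (if i = 1 then 0 else 2) = (0::real)"
    by (intro bexI[of _ 1]) auto
  ultimately show ?thesis
    unfolding null_III_type_def by blast
qed

end
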